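(* For a positive integer $n$ let $b(n)$ be the maximum of $|S|$ over all subsets $S\subseteq\{0,1,\dots,n-1\}^3$ such that no four distinct points of $S$ are coplanar. Then $b(9)\ge 23$, $b(10)\ge 26$, $b(11)\ge 28$, $b(12)\ge 31$, $b(13)\ge 32$, $b(14)\ge 34$, $b(15)\ge 35$, $b(16)\ge 38$, $b(17)\ge 38$, $b(18)\ge 41$, $b(19)\ge 43$, $b(20)\ge 45$, $b(21)\ge 47$, $b(22)\ge 49$, $b(23)\ge 50$, $b(24)\ge 52$, $b(25)\ge 53$, $b(26)\ge 53$, $b(27)\ge 56$, $b(28)\ge 56$, $b(29)\ge 59$.
   Context: Coplanarity is in the usual sense of $\mathbb{R}^3$: four distinct points are coplanar if some (arbitrary) affine plane of $\mathbb{R}^3$ contains all four. In particular, in a set with at least four points and no four coplanar, no three points are collinear. *)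

theory Defs
  imports "HOL-Analysis.Analysis"
begin

definition grid :: "nat \<Rightarrow> (real ^ 3) set" where
  "grid n = {p. \<forall>i. p $ i \<in> real ` {..<n}}"

(* The library's coplanar allows the affine hull of u, v, w to be degenerate; in R^3 such a hull
   still lies in an affine plane, so coplanar T means that some affine plane contains T. *)
definition no_four_coplanar :: "(real ^ 3) set \<Rightarrow> bool" where
  "no_four_coplanar S \<longleftrightarrow> (\<forall>T. T \<subseteq> S \<and> card T = 4 \<longrightarrow> \<not> coplanar T)"

definition b :: "nat \<Rightarrow> nat" where
  "b n = Max {card S | S. S \<subseteq> grid n \<and> no_four_coplanar S}"

lemma finite_grid: "finite (grid n)"
proof -
  have "grid n \<subseteq> (\<lambda>f. \<chi> i. f i) ` (UNIV \<rightarrow>\<^sub>E real ` {..<n})"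
  proof
    fix p assume "p \<in> grid n"
    then have "(\<lambda>i. p $ i) \<in> UNIV \<rightarrow>\<^sub>E real ` {..<n}"
      by (simp add: grid_def PiE_iff extensional_def)
    moreover have "p = (\<chi> i. p $ i)" by (simp add: vec_eq_iff)
    ultimately show "p \<in> (\<lambda>f. \<chi> i. f i) ` (UNIV \<rightarrow>\<^sub>E real ` {..<n})" by blast
  qed
  then show ?thesis
    by (rule finite_subset) (intro finite_imageI finite_PiE, auto)
qed

(* The maximum in the definition of b is over a finite nonempty set, so it is attained. *)
lemma b_candidates:
  "finite {card S | S. S \<subseteq> grid n \<and> no_four_coplanar S}"
  "{card S | S. S \<subseteq> grid n \<and> no_four_coplanar S} \<noteq> {}"
proof -
  have "{card S | S. S \<subseteq> grid n \<and> no_four_coplanar S} \<subseteq> card ` Pow (grid n)" by blast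
  then show "finite {card S | S. S \<subseteq> grid n \<and> no_four_coplanar S}"
    by (rule finite_subset) (simp add: finite_grid)
  have "no_four_coplanar {}" by (auto simp: no_four_coplanar_def)
  then show "{card S | S. S \<subseteq> grid n \<and> no_four_coplanar S} \<noteq> {}" by blast
qed

end

theory Submission
  imports Defs
begin

text \<open>Each bound is witnessed by an explicit set that is invariant under the cyclic permutation of the
  coordinates; in this symmetric space computer search finds large sets. Because of the symmetry it
  suffices to examine coplanar quadruples through one representative \<open>p\<close> of each orbit.
  For a second point \<open>q\<close>, the planes through the line \<open>pq\<close> are parametrised by a slope
  \<open>u / v\<close>, and no quadruple containing \<open>p\<close> and \<open>q\<close> is coplanar iff the slopes of the
  remaining points are distinct. To compare the slopes without cross-multiplying, each is mapped to
  its sign and \<open>h |u| - h |v|\<close>, where \<open>h\<close> is a completely additive function; distinct images imply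
  distinct slopes, and the weights of \<open>h\<close> at the primes are chosen such that no
  collision occurs.\<close>

section \<open>Coplanarity of integer points\<close>

type_synonym point = "int \<times> int \<times> int"

fun det3 :: "point \<Rightarrow> point \<Rightarrow> point \<Rightarrow> int" where
  "det3 (i, j, k) (x, y, z) (x', y', z') =
     i * (y * z' - z * y') - j * (x * z' - z * x') + k * (x * y' - y * x')"

fun disp :: "point \<Rightarrow> point \<Rightarrow> point" where
  "disp (i, j, k) (x, y, z) = (x - i, y - j, z - k)"

text \<open>Integer counterpart of coplanarity: every tetrahedron with vertices in \<open>T\<close>
  has volume zero. Tuples with repeated points satisfy this automatically.\<close>

definition flat :: "point set \<Rightarrow> bool" where
  "flat T \<longleftrightarrow> (\<forall>p\<in>T. \<forall>q\<in>T. \<forall>r\<in>T. \<forall>s\<in>T. det3 (disp p q) (disp p r) (disp p s) = 0)"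

fun emb :: "point \<Rightarrow> real ^ 3" where
  "emb (x, y, z) = vector [of_int x, of_int y, of_int z]"

lemma inj_emb: "inj emb"
proof (rule injI)
  fix p q assume "emb p = emb q"
  then show "p = q" by (cases p; cases q) (simp add: vec_eq_iff forall_3)
qed

text \<open>Three vectors in the span of two vectors \<open>v\<close> and \<open>w\<close> are
  linearly dependent; this is the resulting polynomial identity.\<close>

lemma det3_lin_dep:
  fixes s1 s2 s3 t1 t2 t3 v1 v2 v3 w1 w2 w3 :: real
  shows "(s1 * v1 + t1 * w1) * ((s2 * v2 + t2 * w2) * (s3 * v3 + t3 * w3) - (s2 * v3 + t2 * w3) * (s3 * v2 + t3 * w2))
       - (s1 * v2 + t1 * w2) * ((s2 * v1 + t2 * w1) * (s3 * v3 + t3 * w3) - (s2 * v3 + t2 * w3) * (s3 * v1 + t3 * w1))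
       + (s1 * v3 + t1 * w3) * ((s2 * v1 + t2 * w1) * (s3 * v2 + t3 * w2) - (s2 * v2 + t2 * w2) * (s3 * v1 + t3 * w1)) = 0"
  by (simp add: algebra_simps)

lemma affine_hull_3_coords:
  fixes x :: "real ^ 3"
  assumes "x \<in> affine hull {u, v, w}"
  shows "\<exists>s t. \<forall>i. x $ i = u $ i + s * (v $ i - u $ i) + t * (w $ i - u $ i)"
proof -
  obtain r s t where x: "x = r *\<^sub>R u + s *\<^sub>R v + t *\<^sub>R w" and "r + s + t = 1"
    using assms by (auto simp: affine_hull_3)
  then have r: "r = 1 - s - t" by simp
  have "x $ i = u $ i + s * (v $ i - u $ i) + t * (w $ i - u $ i)" for i
    unfolding x r by (simp add: algebra_simps)
  then show ?thesis by blast
qed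

text \<open>Differences of points in the affine hull of \<open>u, v, w\<close> are combinations of
  \<open>v - u\<close> and \<open>w - u\<close>, so any three of them have determinant zero.\<close>

lemma flat_if_coplanar:
  assumes "coplanar (emb ` T)"
  shows "flat T"
  unfolding flat_def
proof (intro ballI)
  obtain u v w where uvw: "emb ` T \<subseteq> affine hull {u, v, w}"
    using assms by (auto simp: coplanar_def)
  fix p q r s assume "p \<in> T" "q \<in> T" "r \<in> T" "s \<in> T"
  then have mem: "emb p \<in> affine hull {u, v, w}" "emb q \<in> affine hull {u, v, w}"
    "emb r \<in> affine hull {u, v, w}" "emb s \<in> affine hull {u, v, w}"
    using uvw by auto
  obtain s0 t0 where p: "\<forall>i. emb p $ i = u $ i + s0 * (v $ i - u $ i) + t0 * (w $ i - u $ i)"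
    using affine_hull_3_coords[OF mem(1)] by blast
  obtain s1 t1 where q: "\<forall>i. emb q $ i = u $ i + s1 * (v $ i - u $ i) + t1 * (w $ i - u $ i)"
    using affine_hull_3_coords[OF mem(2)] by blast
  obtain s2 t2 where r: "\<forall>i. emb r $ i = u $ i + s2 * (v $ i - u $ i) + t2 * (w $ i - u $ i)"
    using affine_hull_3_coords[OF mem(3)] by blast
  obtain s3 t3 where s: "\<forall>i. emb s $ i = u $ i + s3 * (v $ i - u $ i) + t3 * (w $ i - u $ i)"
    using affine_hull_3_coords[OF mem(4)] by blast
  obtain p1 p2 p3 q1 q2 q3 r1 r2 r3 z1 z2 z3
    where eqs: "p = (p1, p2, p3)" "q = (q1, q2, q3)" "r = (r1, r2, r3)" "s = (z1, z2, z3)"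
    by (cases p; cases q; cases r; cases s) auto
  have diff: "emb q $ i - emb p $ i = (s1 - s0) * (v $ i - u $ i) + (t1 - t0) * (w $ i - u $ i)"
       "emb r $ i - emb p $ i = (s2 - s0) * (v $ i - u $ i) + (t2 - t0) * (w $ i - u $ i)"
       "emb s $ i - emb p $ i = (s3 - s0) * (v $ i - u $ i) + (t3 - t0) * (w $ i - u $ i)" for i
    by (simp_all add: p[rule_format] q[rule_format] r[rule_format] s[rule_format] algebra_simps)
  have "real_of_int (det3 (disp p q) (disp p r) (disp p s)) =
     (emb q $ 1 - emb p $ 1) * ((emb r $ 2 - emb p $ 2) * (emb s $ 3 - emb p $ 3)
       - (emb r $ 3 - emb p $ 3) * (emb s $ 2 - emb p $ 2))
   - (emb q $ 2 - emb p $ 2) * ((emb r $ 1 - emb p $ 1) * (emb s $ 3 - emb p $ 3)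
       - (emb r $ 3 - emb p $ 3) * (emb s $ 1 - emb p $ 1))
   + (emb q $ 3 - emb p $ 3) * ((emb r $ 1 - emb p $ 1) * (emb s $ 2 - emb p $ 2)
       - (emb r $ 2 - emb p $ 2) * (emb s $ 1 - emb p $ 1))"
    by (simp add: eqs)
  also have "\<dots> = 0"
    unfolding diff by (rule det3_lin_dep)
  finally show "det3 (disp p q) (disp p r) (disp p s) = 0" by simp
qed

section \<open>Slopes and their hash keys\<close>

(* The weights p^3 + 18 produce no collision between the slopes of the configurations below. *)
definition additive_hash :: "nat \<Rightarrow> nat" where
  "additive_hash n = (\<Sum>p\<in>#prime_factorization n. p ^ 3 + 18)"

lemma additive_hash_mult:
  "m \<noteq> 0 \<Longrightarrow> n \<noteq> 0 \<Longrightarrow> additive_hash (m * n) = additive_hash m + additive_hash n"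
  by (simp add: additive_hash_def prime_factorization_mult)

lemma additive_hash_prime: "prime p \<Longrightarrow> additive_hash p = p ^ 3 + 18"
  by (simp add: additive_hash_def prime_factorization_prime)

definition hash :: "int \<Rightarrow> int" where
  "hash u = int (additive_hash (nat u))"

(* hash_num is kept apart from hash so that its values can be tabulated as rewrite rules whose
   right-hand sides are themselves evaluated with rules for hash. *)
definition hash_num :: "int \<Rightarrow> int" where
  "hash_num u = hash u"

(* The constant exceeds all hash values that are used, which keeps the argument of num_of_int
   in key positive (num_of_nat maps 0 to One). *)
definition hash_den :: "int \<Rightarrow> int" where
  "hash_den v = 230346416 - hash v"

definition num_of_int :: "int \<Rightarrow> num" where
  "num_of_int k = num_of_nat (nat k)"

text \<open>The sign of the slope is the lowest bit and the hash difference stands above it; 1 and 2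
  encode the slopes 0 and infinity. A coincidence of keys of unequal slopes can only make a check
  fail.\<close>

definition key :: "int \<Rightarrow> int \<Rightarrow> num" where
  "key u v =
    (if u = 0 then num.One
     else if v = 0 then num.Bit0 num.One
     else if 0 < u \<longleftrightarrow> 0 < v then num.Bit0 (num_of_int (hash_num \<bar>u\<bar> + hash_den \<bar>v\<bar>))
     else num.Bit1 (num_of_int (hash_num \<bar>u\<bar> + hash_den \<bar>v\<bar>)))"

lemma key_cong:
  assumes "u * v' = u' * v" "(u, v) \<noteq> (0, 0)" "(u', v') \<noteq> (0, 0)"
  shows "key u v = key u' v'"
proof (cases "u = 0 \<or> v = 0")
  case True
  then show ?thesis using assms by (auto simp: key_def)
next
  case False
  then have nz: "u \<noteq> 0" "v \<noteq> 0" "u' \<noteq> 0" "v' \<noteq> 0" using assms by auto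
  have "nat \<bar>u\<bar> * nat \<bar>v'\<bar> = nat \<bar>u'\<bar> * nat \<bar>v\<bar>"
    using assms(1) by (simp flip: nat_mult_distrib abs_mult)
  then have "additive_hash (nat \<bar>u\<bar>) + additive_hash (nat \<bar>v'\<bar>) = additive_hash (nat \<bar>u'\<bar>) + additive_hash (nat \<bar>v\<bar>)"
    using nz by (metis additive_hash_mult nat_0_iff abs_le_zero_iff)
  then have hash: "hash_num \<bar>u\<bar> + hash_den \<bar>v\<bar> = hash_num \<bar>u'\<bar> + hash_den \<bar>v'\<bar>"
    by (simp add: hash_num_def hash_den_def hash_def)
  have sq: "0 < v * v" "0 < v' * v'" using nz by (auto simp: zero_less_mult_iff)
  \<comment> \<open>Multiplying by squares preserves signs, so \<open>u * v\<close> and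
    \<open>u' * v'\<close> are compared through a common value.\<close>
  have "0 < u * v \<longleftrightarrow> 0 < (u * v) * (v' * v')"
    using sq(2) by (metis mult_pos_pos zero_less_mult_pos2)
  also have "(u * v) * (v' * v') = (u' * v') * (v * v)"
    using assms(1) by (simp add: algebra_simps)
  also have "0 < \<dots> \<longleftrightarrow> 0 < u' * v'"
    using sq(1) by (metis mult_pos_pos zero_less_mult_pos2)
  finally have "(0 < u \<longleftrightarrow> 0 < v) \<longleftrightarrow> (0 < u' \<longleftrightarrow> 0 < v')"
    using nz by (auto simp: zero_less_mult_iff)
  then show ?thesis using nz hash by (simp add: key_def)
qed

text \<open>Coordinates, free of denominators, on the quotient of space by the line spanned by the
  first argument; the last nonzero entry of that vector selects the formula.\<close>

fun proj :: "point \<Rightarrow> point \<Rightarrow> int \<times> int" where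
  "proj (i, j, k) (x, y, z) =
    (if k \<noteq> 0 then (k * x - i * z, k * y - j * z)
     else if j \<noteq> 0 then (j * x - i * y, z)
     else (y, z))"

lemma proj_parallel:
  assumes "d \<noteq> (0, 0, 0)" "det3 d w w' = 0" "proj d w = (u, v)" "proj d w' = (u', v')"
  shows "u * v' = u' * v"
proof -
  obtain i j k x y z x' y' z'
    where eqs: "d = (i, j, k)" "w = (x, y, z)" "w' = (x', y', z')"
    by (cases d; cases w; cases w') auto
  \<comment> \<open>In each branch of \<open>proj\<close>, the 2 by 2 determinant of the projections
    agrees with \<open>det3 d w w'\<close> up to a factor. In the last branch the factor
    \<open>i\<close> has to be cancelled; it is nonzero because \<open>d\<close> is.\<close>
  have "(k * x - i * z) * (k * y' - j * z') - (k * x' - i * z') * (k * y - j * z) = k * det3 d w w'"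
    by (simp add: eqs algebra_simps)
  moreover have "(j * x - i * y) * z' - (j * x' - i * y') * z = - det3 d w w'" if "k = 0"
    using that by (simp add: eqs algebra_simps)
  moreover have "i * (y * z' - y' * z) = det3 d w w'" if "k = 0" "j = 0"
    using that by (simp add: eqs algebra_simps)
  ultimately show ?thesis
    using assms by (auto simp: eqs split: if_splits)
qed

text \<open>The list \<open>ks\<close> accumulates the keys already computed, so that the list of
  vectors can be processed one at a time.\<close>

definition scan :: "point \<Rightarrow> point list \<Rightarrow> num list \<Rightarrow> bool" where
  "scan d ws ks \<longleftrightarrow>
     d \<noteq> (0, 0, 0) \<and> (\<forall>w\<in>set ws. proj d w \<noteq> (0, 0)) \<and>
     distinct (map (\<lambda>w. case_prod key (proj d w)) ws @ ks)"

lemma scan_det3: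
  assumes "scan d ws ks" "w \<in> set ws" "w' \<in> set ws" "w \<noteq> w'"
  shows "det3 d w w' \<noteq> 0"
proof
  assume 0: "det3 d w w' = 0"
  obtain u v u' v' where uv: "proj d w = (u, v)" "proj d w' = (u', v')"
    by (cases "proj d w"; cases "proj d w'") auto
  have "d \<noteq> (0, 0, 0)" "(u, v) \<noteq> (0, 0)" "(u', v') \<noteq> (0, 0)"
    and inj: "inj_on (\<lambda>w. case_prod key (proj d w)) (set ws)"
    using assms uv by (auto simp: scan_def distinct_map)
  then have "key u v = key u' v'"
    using proj_parallel[OF _ 0 uv] key_cong by blast
  then show False
    using inj_onD[OF inj] assms(2-4) uv by auto
qed

fun fan :: "point list \<Rightarrow> bool" where
  "fan [] = True"
| "fan (w # ws) = (scan w ws [] \<and> fan ws)"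

lemma det3_swap: "det3 q p r = - det3 p q r" "det3 p r q = - det3 p q r"
  by (cases p; cases q; cases r; simp add: algebra_simps)+

text \<open>Of three members, the one that comes first in the list serves as the direction of the
  scan; reordering the arguments of the determinant changes at most its sign.\<close>

lemma fan_det3:
  assumes "fan ws" "{p, q, r} \<subseteq> set ws" "p \<noteq> q" "p \<noteq> r" "q \<noteq> r"
  shows "det3 p q r \<noteq> 0"
  using assms
proof (induction ws)
  case (Cons w ws)
  then have scan: "scan w ws []" by simp
  have first: "det3 w s t \<noteq> 0" if "s \<in> set ws" "t \<in> set ws" "s \<noteq> t" for s t
    using scan_det3[OF scan that] .
  consider "{p, q, r} \<subseteq> set ws" | "p = w" "{q, r} \<subseteq> set ws" | "q = w" "{p, r} \<subseteq> set ws"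
    | "r = w" "{p, q} \<subseteq> set ws"
    using Cons.prems by auto
  then show ?case
  proof cases
    case 1 then show ?thesis using Cons by simp
  next
    case 2 then show ?thesis using first Cons.prems by simp
  next
    case 3 then show ?thesis using first[of p r] Cons.prems det3_swap(1)[of p q r] by simp
  next
    case 4 then show ?thesis
      using first[of p q] Cons.prems det3_swap(1)[of p r q] det3_swap(2)[of p r q] by simp
  qed
qed simp

section \<open>Sets invariant under the cyclic permutation of the coordinates\<close>

fun cyc :: "point \<Rightarrow> point" where
  "cyc (x, y, z) = (y, z, x)"

lemma cyc_cyc_cyc [simp]: "cyc (cyc (cyc p)) = p"
  by (cases p) simp

lemma inj_cyc: "inj cyc"
  by (metis injI cyc_cyc_cyc)

text \<open>A cyclic permutation of three coordinates is even, so it preserves determinants.\<close>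

lemma flat_cyc: "flat T \<Longrightarrow> flat (cyc ` T)"
  unfolding flat_def
proof (intro ballI)
  fix p q r s
  assume flat: "\<forall>p\<in>T. \<forall>q\<in>T. \<forall>r\<in>T. \<forall>s\<in>T. det3 (disp p q) (disp p r) (disp p s) = 0"
    and "p \<in> cyc ` T" "q \<in> cyc ` T" "r \<in> cyc ` T" "s \<in> cyc ` T"
  then obtain p' q' r' s' where eqs: "p = cyc p'" "q = cyc q'" "r = cyc r'" "s = cyc s'"
    and "p' \<in> T" "q' \<in> T" "r' \<in> T" "s' \<in> T" by blast
  then have "det3 (disp p' q') (disp p' r') (disp p' s') = 0" using flat by blast
  then show "det3 (disp p q) (disp p r) (disp p s) = 0"
    unfolding eqs by (cases p'; cases q'; cases r'; cases s') (simp add: algebra_simps)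
qed

fun orbits :: "point list \<Rightarrow> point list" where
  "orbits [] = []"
| "orbits (p # ps) = p # cyc p # cyc (cyc p) # orbits ps"

(* A coplanar set that meets the orbit of p can be rotated so that it contains p itself, so only
   quadruples through the representatives have to be examined. The points ds are fixed by cyc. *)
fun check :: "point list \<Rightarrow> point list \<Rightarrow> bool" where
  "check ds [] = True"
| "check ds (p # ps) = (fan (map (disp p) (cyc p # cyc (cyc p) # orbits ps @ ds)) \<and> check ds ps)"

lemma cyc_orbits: "q \<in> set (orbits ps) \<Longrightarrow> cyc q \<in> set (orbits ps)"
  by (induction ps) auto

lemma inj_disp: "inj (disp p)"
proof (rule injI)
  fix q r assume "disp p q = disp p r"
  then show "q = r" by (cases p; cases q; cases r) auto
qed

lemma check_not_flat:
  assumes "check ds ps" "\<forall>d\<in>set ds. cyc d = d" "length ds \<le> 3"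
    and "T \<subseteq> set (orbits ps @ ds)" "card T = 4"
  shows "\<not> flat T"
  using assms
proof (induction ps arbitrary: T)
  case Nil
  \<comment> \<open>Once all orbits are removed only the at most three points of \<open>ds\<close>
    remain, too few for a quadruple.\<close>
  then have "card T \<le> length ds"
    by (metis append_Nil card_length card_mono finite_set le_trans orbits.simps(1))
  with Nil show ?case by simp
next
  case (Cons p ps)
  let ?O = "{p, cyc p, cyc (cyc p)}"
  have step: "\<not> flat U" if U: "U \<subseteq> set (orbits (p # ps) @ ds)" "card U = 4" "p \<in> U" for U
  proof
    assume "flat U"
    have "card (U - {p}) = 3" using U by (simp add: card_Diff_singleton)
    then obtain q r s where qrs: "U - {p} = {q, r, s}" "q \<noteq> r" "q \<noteq> s" "r \<noteq> s"
      by (auto simp: card_3_iff)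
    have "det3 (disp p q) (disp p r) (disp p s) \<noteq> 0"
    proof (rule fan_det3)
      show "fan (map (disp p) (cyc p # cyc (cyc p) # orbits ps @ ds))"
        using Cons.prems by simp
      have "{q, r, s} \<subseteq> set (cyc p # cyc (cyc p) # orbits ps @ ds)"
        using qrs(1) U(1) by auto
      then show "{disp p q, disp p r, disp p s} \<subseteq> set (map (disp p) (cyc p # cyc (cyc p) # orbits ps @ ds))"
        by auto
    qed (use qrs inj_disp[of p] in \<open>auto dest: injD\<close>)
    moreover have "p \<in> U" "q \<in> U" "r \<in> U" "s \<in> U" using qrs(1) U(3) by auto
    ultimately show False using \<open>flat U\<close> by (auto simp: flat_def)
  qed
  have closed: "cyc ` U \<subseteq> set (orbits (p # ps) @ ds)" if "U \<subseteq> set (orbits (p # ps) @ ds)" for U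
  proof (rule image_subsetI)
    fix q assume "q \<in> U"
    then have "q \<in> set (orbits (p # ps)) \<or> q \<in> set ds" using that by (auto simp del: orbits.simps)
    then show "cyc q \<in> set (orbits (p # ps) @ ds)"
      using cyc_orbits[of q "p # ps"] Cons.prems(2) by (auto simp del: orbits.simps)
  qed
  have card: "card (cyc ` U) = card U" for U
    by (intro card_image inj_on_subset[OF inj_cyc]) simp
  \<comment> \<open>A set that misses the orbit is left to the induction hypothesis; any other is
    rotated until it contains \<open>p\<close>.\<close>
  consider "?O \<inter> T = {}" | "p \<in> T" | "cyc p \<in> T" | "cyc (cyc p) \<in> T" by auto
  then show ?case
  proof cases
    case 1
    then have "T \<subseteq> set (orbits ps @ ds)" using Cons.prems(4) by auto
    then show ?thesis using Cons by auto
  next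
    case 2 then show ?thesis using step Cons.prems by blast
  next
    case 3
    then have "p \<in> cyc ` cyc ` T" by (metis cyc_cyc_cyc imageI)
    then show ?thesis
      using step[of "cyc ` cyc ` T"] closed Cons.prems(4,5) flat_cyc by (metis card)
  next
    case 4
    then have "p \<in> cyc ` T" by (metis cyc_cyc_cyc imageI)
    then show ?thesis
      using step[of "cyc ` T"] closed Cons.prems(4,5) flat_cyc by (metis card)
  qed
qed

section \<open>Lower bounds from checked configurations\<close>

definition inside :: "nat \<Rightarrow> point \<Rightarrow> bool" where
  "inside n = (\<lambda>(x, y, z). {x, y, z} \<subseteq> {0..<int n})"

lemma emb_in_grid:
  assumes "inside n p"
  shows "emb p \<in> grid n"
proof -
  have "real_of_int x \<in> real ` {..<n}" if "x \<in> {0..<int n}" for x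
    using that by (intro image_eqI[of _ _ "nat x"]) auto
  then show ?thesis
    using assms by (cases p) (auto simp: inside_def grid_def forall_3)
qed

lemma b_ge:
  assumes "S \<subseteq> grid n" "no_four_coplanar S"
  shows "card S \<le> b n"
  unfolding b_def using assms b_candidates(1) by (intro Max_ge) auto

lemma b_mono:
  assumes "m \<le> n"
  shows "b m \<le> b n"
proof -
  have "b m \<in> {card S | S. S \<subseteq> grid m \<and> no_four_coplanar S}"
    unfolding b_def by (intro Max_in b_candidates)
  then obtain S where S: "b m = card S" "S \<subseteq> grid m" "no_four_coplanar S" by blast
  have "grid m \<subseteq> grid n" using assms by (fastforce simp: grid_def)
  then show ?thesis using S b_ge[of S n] by simp
qed

text \<open>The fixed points of \<open>cyc\<close> are the diagonal points \<open>(x, x, x)\<close>,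
  so \<open>ds\<close> records just their common coordinate.\<close>

lemma config_bound:
  fixes ds :: "int list" and ps :: "point list"
  defines "qs \<equiv> orbits ps @ map (\<lambda>x. (x, x, x)) ds"
  assumes "check (map (\<lambda>x. (x, x, x)) ds) ps" "length ds \<le> 3"
    and "list_all (inside n) qs" "distinct qs" "length qs = k"
  shows "k \<le> b n"
proof -
  have "no_four_coplanar (emb ` set qs)"
    unfolding no_four_coplanar_def
  proof (intro allI impI notI)
    fix T assume T: "T \<subseteq> emb ` set qs \<and> card T = 4" and cop: "coplanar T"
    then obtain U where U: "T = emb ` U" "U \<subseteq> set qs" by (auto simp: subset_image_iff)
    moreover have "card T = card U"
      unfolding U by (intro card_image inj_on_subset[OF inj_emb]) simp
    ultimately show False
      using check_not_flat[OF assms(2), of U] flat_if_coplanar[of U] assms(3) T cop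
      by (auto simp: qs_def)
  qed
  moreover have "emb ` set qs \<subseteq> grid n"
    using assms(4) emb_in_grid by (auto simp: list_all_iff)
  ultimately have "card (emb ` set qs) \<le> b n" by (rule b_ge[rotated])
  moreover have "card (emb ` set qs) = card (set qs)"
    by (intro card_image inj_on_subset[OF inj_emb]) simp
  ultimately show ?thesis using assms(5,6) by (simp add: distinct_card)
qed

section \<open>Rewrite rules for evaluating the check\<close>

text \<open>With integers written by the constructors \<open>0\<close>, \<open>Int.Pos\<close> and
  \<open>Int.Neg\<close>, the code equations become unconditional rewrite rules.\<close>

lemma numeral_Pos: "(numeral :: num \<Rightarrow> int) = Int.Pos" "(1 :: int) = Int.Pos num.One"
  by (simp_all add: Int.Pos_def)

text \<open>Started at \<open>num.One\<close>, depth \<open>d\<close> covers 1 to 2^d - 1. Unfolding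
  gives one conjunct per numeral, and hence a table of rewrite rules.\<close>

fun num_tree :: "(num \<Rightarrow> bool) \<Rightarrow> nat \<Rightarrow> num \<Rightarrow> bool" where
  "num_tree P 0 n = True"
| "num_tree P (Suc d) n = (P n \<and> num_tree P d (num.Bit0 n) \<and> num_tree P d (num.Bit1 n))"

lemma num_treeI: "(\<And>n. P n) \<Longrightarrow> num_tree P d n"
  by (induction d arbitrary: n) auto

lemma num_tree_numeral:
  "num_tree P (numeral k) n =
    (P n \<and> num_tree P (pred_numeral k) (num.Bit0 n) \<and> num_tree P (pred_numeral k) (num.Bit1 n))"
  by (simp add: numeral_eq_Suc)

lemmas arith_rules =
  numeral_Pos Int.plus_int_code Int.minus_int_code Int.uminus_int_code Int.times_int_code
  Int.sub_code Int.dup_code Num.BitM.simps Num.add_num_simps Num.mult_num_simps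

lemmas num_tree_rules =
  num_tree.simps(1) num_tree_numeral Num.pred_numeral_simps list.pred_inject prod.case simp_thms

section \<open>Hash values of the integers up to 615\<close>

lemma hash_prime_mult:
  assumes "prime p" "0 < k"
  shows "hash (p * k) = p * p * p + 18 + hash k"
proof -
  have "prime (nat p)" "0 < p" using assms(1) prime_int_nat_transfer[of p] prime_gt_0_int[of p] by blast+
  then show ?thesis
    using assms(2) additive_hash_mult[of "nat p" "nat k"]
    by (simp add: hash_def nat_mult_distrib additive_hash_prime power3_eq_cube)
qed

lemma hash_1: "hash 1 = 0"
  by (simp add: hash_def additive_hash_def)

(* The depths d are such that the multiples of p up to 615, the largest argument of hash that
   occurs for the configurations below, are covered. *)
lemma hash_smooth:
  "list_all (\<lambda>(d, p). num_tree (\<lambda>k. hash (p * Int.Pos k) = p * p * p + 18 + hash (Int.Pos k)) d num.One)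
     [(9, 2), (8, 3), (7, 5), (7, 7), (6, 11), (6, 13), (6, 17), (6, 19), (5, 23)]"
  unfolding list_all_iff
proof clarify
  fix d :: nat and p :: int
  assume "(d, p) \<in> set [(9, 2), (8, 3), (7, 5), (7, 7), (6, 11), (6, 13), (6, 17), (6, 19), (5, 23)]"
  then have "prime p" by auto
  then show "num_tree (\<lambda>k. hash (p * Int.Pos k) = p * p * p + 18 + hash (Int.Pos k)) d num.One"
    by (intro num_treeI hash_prime_mult) (simp_all add: Int.Pos_def)
qed

text \<open>Trial division: 841 is the square of 29, and the nine listed numbers are the primes
  below 29.\<close>

lemma prime_if_no_small_factor:
  fixes n :: nat
  assumes "1 < n" "n < 841" "\<forall>q\<in>{2, 3, 5, 7, 11, 13, 17, 19, 23}. \<not> q dvd n"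
  shows "prime n"
proof (rule ccontr)
  assume "\<not> prime n"
  then obtain m where "m dvd n" "m \<noteq> 1" "m \<noteq> n"
    using assms(1) by (auto simp: prime_nat_iff)
  then obtain k where n: "n = m * k" "m \<noteq> 1" "k \<noteq> 1" by auto
  then have mk: "1 < m" "1 < k" using assms(1) by (metis less_one linorder_neqE_nat mult_0 mult_0_right not_less_zero)+
  have "min m k * min m k \<le> m * k" by (intro mult_mono) auto
  then have "min m k * min m k < 29 * 29" using assms(2) n(1) by simp
  then have "min m k < 29" by (metis not_less mult_le_mono)
  moreover have "min m k dvd n" "1 < min m k" using n(1) mk by (auto simp: min_def)
  moreover obtain q where "prime q" "q dvd min m k"
    using mk by (metis min_def nat_neq_iff prime_factor_nat)
  ultimately have q: "prime q" "q dvd n" "q < 29"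
    using dvd_imp_le[of q "min m k"] by (auto intro: dvd_trans)
  have "q \<in> set [2..<29]"
    using prime_ge_2_nat[OF q(1)] q(3) by (simp only: set_upt atLeastLessThan_iff)
  then have "q \<in> {2, 3, 5, 7, 11, 13, 17, 19, 23}"
    using q(1) by (auto simp: upt_rec_numeral simp del: set_upt)
  then show False using assms(3) q(2) by blast
qed

text \<open>These are the primes from 29 to 615. Every number from 2 to 615 without a prime factor
  below 29 is among them.\<close>

lemma hash_prime:
  "list_all (\<lambda>p :: nat. hash (int p) = int p * int p * int p + 18)
     [29, 31, 37, 41, 43, 47, 53, 59, 61, 67, 71, 73, 79, 83, 89, 97, 101, 103, 107, 109, 113,
      127, 131, 137, 139, 149, 151, 157, 163, 167, 173, 179, 181, 191, 193, 197, 199, 211, 223,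
      227, 229, 233, 239, 241, 251, 257, 263, 269, 271, 277, 281, 283, 293, 307, 311, 313, 317,
      331, 337, 347, 349, 353, 359, 367, 373, 379, 383, 389, 397, 401, 409, 419, 421, 431, 433,
      439, 443, 449, 457, 461, 463, 467, 479, 487, 491, 499, 503, 509, 521, 523, 541, 547, 557,
      563, 569, 571, 577, 587, 593, 599, 601, 607, 613]" (is "list_all _ ?ps")
proof (rule list.pred_mono_strong)
  show "list_all (\<lambda>p. 1 < p \<and> p < 841 \<and> (\<forall>q\<in>{2, 3, 5, 7, 11, 13, 17, 19, 23}. \<not> q dvd p)) ?ps"
    by simp
next
  fix p :: nat
  assume "1 < p \<and> p < 841 \<and> (\<forall>q\<in>{2, 3, 5, 7, 11, 13, 17, 19, 23}. \<not> q dvd p)"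
  then have "prime (int p)" using prime_if_no_small_factor[of p] by simp
  then show "hash (int p) = int p * int p * int p + 18"
    using hash_prime_mult[of "int p" 1] by (simp add: hash_1)
qed

text \<open>Depth 10 reaches 1023, beyond the largest argument 615. Simplifying the right-hand sides
  once turns the entries up to 615 into explicit values.\<close>

lemma hash_num_den:
  "num_tree (\<lambda>n. hash_num (Int.Pos n) = hash (Int.Pos n) \<and>
     hash_den (Int.Pos n) = 230346416 - hash (Int.Pos n)) 10 num.One"
  by (simp add: num_treeI hash_num_def hash_den_def)

lemmas hash_step_rules =
  hash_1[simplified arith_rules]
  hash_smooth[simplified num_tree_rules arith_rules] hash_prime[simplified num_tree_rules of_nat_numeral arith_rules]

lemmas hash_rules = hash_num_den[simplified num_tree_rules arith_rules hash_step_rules]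

section \<open>Evaluation of scans and keys by unconditional rules\<close>

lemma scan_Nil: "d \<noteq> (0, 0, 0) \<Longrightarrow> scan d [] ks = distinct ks"
  by (simp add: scan_def)

text \<open>Intermediate state in which the projection \<open>(u, v)\<close> is normalised before
  its signs are matched.\<close>

definition put :: "int \<Rightarrow> int \<Rightarrow> point \<Rightarrow> point list \<Rightarrow> num list \<Rightarrow> bool" where
  "put u v d ws ks \<longleftrightarrow> (u \<noteq> 0 \<or> v \<noteq> 0) \<and> scan d ws (key u v # ks)"

lemma scan_Cons: "scan d (w # ws) ks = (case proj d w of (u, v) \<Rightarrow> put u v d ws ks)"
  by (auto simp: scan_def put_def split: prod.split)

lemma Pos_Neg_simps:
  "Int.Pos m \<noteq> 0" "Int.Neg m \<noteq> 0" "0 < Int.Pos m" "\<not> 0 < Int.Neg m"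
  "\<bar>Int.Pos m\<bar> = Int.Pos m" "\<bar>Int.Neg m\<bar> = Int.Pos m"
  by (simp_all add: Int.Pos_def Int.Neg_def)

lemma scan_rules:
  "scan (i, j, Int.Pos m) [] ks = distinct ks"
  "scan (i, j, Int.Neg m) [] ks = distinct ks"
  "scan (i, Int.Pos m, 0) [] ks = distinct ks"
  "scan (i, Int.Neg m, 0) [] ks = distinct ks"
  "scan (Int.Pos m, 0, 0) [] ks = distinct ks"
  "scan (Int.Neg m, 0, 0) [] ks = distinct ks"
  "scan (i, j, Int.Pos m) ((x, y, z) # ws) ks =
     put (Int.Pos m * x - i * z) (Int.Pos m * y - j * z) (i, j, Int.Pos m) ws ks"
  "scan (i, j, Int.Neg m) ((x, y, z) # ws) ks =
     put (Int.Neg m * x - i * z) (Int.Neg m * y - j * z) (i, j, Int.Neg m) ws ks"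
  "scan (i, Int.Pos m, 0) ((x, y, z) # ws) ks = put (Int.Pos m * x - i * y) z (i, Int.Pos m, 0) ws ks"
  "scan (i, Int.Neg m, 0) ((x, y, z) # ws) ks = put (Int.Neg m * x - i * y) z (i, Int.Neg m, 0) ws ks"
  "scan (Int.Pos m, 0, 0) ((x, y, z) # ws) ks = put y z (Int.Pos m, 0, 0) ws ks"
  "scan (Int.Neg m, 0, 0) ((x, y, z) # ws) ks = put y z (Int.Neg m, 0, 0) ws ks"
  by (simp_all add: scan_Nil scan_Cons Pos_Neg_simps)

lemma put_rules:
  "put (Int.Pos m) (Int.Pos n) d ws ks =
     scan d ws (num.Bit0 (num_of_int (hash_num (Int.Pos m) + hash_den (Int.Pos n))) # ks)"
  "put (Int.Neg m) (Int.Neg n) d ws ks =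
     scan d ws (num.Bit0 (num_of_int (hash_num (Int.Pos m) + hash_den (Int.Pos n))) # ks)"
  "put (Int.Pos m) (Int.Neg n) d ws ks =
     scan d ws (num.Bit1 (num_of_int (hash_num (Int.Pos m) + hash_den (Int.Pos n))) # ks)"
  "put (Int.Neg m) (Int.Pos n) d ws ks =
     scan d ws (num.Bit1 (num_of_int (hash_num (Int.Pos m) + hash_den (Int.Pos n))) # ks)"
  "put 0 (Int.Pos n) d ws ks = scan d ws (num.One # ks)"
  "put 0 (Int.Neg n) d ws ks = scan d ws (num.One # ks)"
  "put (Int.Pos m) 0 d ws ks = scan d ws (num.Bit0 num.One # ks)"
  "put (Int.Neg m) 0 d ws ks = scan d ws (num.Bit0 num.One # ks)"
  by (simp_all add: put_def key_def Pos_Neg_simps)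

lemma num_of_int_Pos: "num_of_int (Int.Pos k) = k"
  by (simp add: num_of_int_def Int.Pos_def num_of_nat_numeral_eq)

(* Distinctness of a list of binary numerals is decided by splitting it on the lowest bit, which
   takes about log n rewrite steps for each of the n entries instead of n comparisons. *)
definition radix :: "num list \<Rightarrow> num list \<Rightarrow> num list \<Rightarrow> bool" where
  "radix ks ls ms \<longleftrightarrow> distinct (ks @ map num.Bit0 ls @ map num.Bit1 ms)"

text \<open>The state of the splitting after \<open>num.One\<close> has occurred; a second
  occurrence matches no rule, so a duplicate blocks the evaluation.\<close>

definition radix1 :: "num list \<Rightarrow> num list \<Rightarrow> num list \<Rightarrow> bool" where
  "radix1 ks ls ms \<longleftrightarrow> distinct (num.One # ks @ map num.Bit0 ls @ map num.Bit1 ms)"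

lemma distinct_rules:
  "distinct ([] :: num list)"
  "distinct [k :: num]"
  "distinct (k # l # ks) = radix (k # l # ks) [] []"
  "radix [] ls ms = (distinct ls \<and> distinct ms)"
  "radix (num.Bit0 k # ks) ls ms = radix ks (k # ls) ms"
  "radix (num.Bit1 k # ks) ls ms = radix ks ls (k # ms)"
  "radix (num.One # ks) ls ms = radix1 ks ls ms"
  "radix1 [] ls ms = (distinct ls \<and> distinct ms)"
  "radix1 (num.Bit0 k # ks) ls ms = radix1 ks (k # ls) ms"
  "radix1 (num.Bit1 k # ks) ls ms = radix1 ks ls (k # ms)"
  by (auto simp: radix_def radix1_def distinct_map inj_on_def)

lemmas check_rules =
  check.simps fan.simps orbits.simps cyc.simps disp.simps list.map append.simps simp_thms
  arith_rules
  scan_rules put_rules hash_rules num_of_int_Pos distinct_rules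

section \<open>The configurations\<close>

text \<open>Seven orbits of three points and two diagonal points: 3 * 7 + 2 = 23. The other
  configurations are counted in the same way.\<close>

lemma b_9: "23 \<le> b 9"
  by (rule config_bound[where ds = "[6, 5]" and ps =
    "[(1, 2, 3), (1, 7, 2), (3, 8, 6), (0, 5, 7), (0, 1, 6), (0, 7, 4), (2, 4, 8)]"],
      simp only: check_rules, simp_all add: inside_def)

lemma b_10: "26 \<le> b 10"
  by (rule config_bound[where ds = "[7, 8]" and ps =
    "[(0, 7, 5), (3, 3, 9), (0, 2, 9), (2, 8, 6), (0, 4, 1), (6, 9, 7), (1, 5, 8), (1, 2, 6)]"],
      simp only: check_rules, simp_all add: inside_def)

lemma b_11: "28 \<le> b 11"
  by (rule config_bound[where ds = "[9]" and ps =
    "[(5, 9, 8), (0, 1, 6), (2, 10, 7), (3, 7, 10), (1, 9, 3), (0, 7, 5), (0, 8, 1), (5, 6, 10),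
      (2, 2, 4)]"],
      simp only: check_rules, simp_all add: inside_def)

lemma b_12: "31 \<le> b 12"
  by (rule config_bound[where ds = "[10]" and ps =
    "[(2, 11, 7), (3, 11, 4), (8, 8, 11), (6, 9, 10), (1, 2, 3), (0, 8, 5), (3, 5, 9), (0, 9, 1),
      (2, 7, 10), (0, 7, 1)]"],
      simp only: check_rules, simp_all add: inside_def)

lemma b_13: "32 \<le> b 13"
  by (rule config_bound[where ds = "[12, 1]" and ps =
    "[(0, 4, 10), (2, 10, 9), (1, 8, 2), (0, 5, 7), (2, 12, 5), (7, 12, 9), (6, 7, 11),
      (1, 6, 10), (0, 11, 5), (3, 11, 9)]"],
      simp only: check_rules, simp_all add: inside_def)

lemma b_14: "34 \<le> b 14"
  by (rule config_bound[where ds = "[5]" and ps =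
    "[(1, 12, 10), (4, 8, 13), (0, 8, 1), (5, 11, 13), (0, 2, 3), (0, 10, 6), (2, 5, 12),
      (1, 6, 7), (6, 13, 7), (3, 4, 11), (2, 8, 12)]"],
      simp only: check_rules, simp_all add: inside_def)

lemma b_15: "35 \<le> b 15"
  by (rule config_bound[where ds = "[8, 12]" and ps =
    "[(7, 13, 11), (1, 14, 12), (0, 8, 5), (7, 14, 8), (1, 3, 13), (0, 11, 5), (1, 4, 14),
      (2, 10, 11), (0, 4, 3), (2, 4, 6), (5, 12, 13)]"],
      simp only: check_rules, simp_all add: inside_def)

lemma b_16: "38 \<le> b 16"
  by (rule config_bound[where ds = "[5, 7]" and ps =
    "[(7, 15, 10), (0, 13, 15), (0, 3, 8), (3, 4, 11), (1, 9, 12), (4, 15, 14), (2, 14, 3),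
      (0, 4, 2), (5, 7, 13), (1, 14, 8), (2, 6, 12), (10, 11, 13)]"],
      simp only: check_rules, simp_all add: inside_def)

lemma b_18: "41 \<le> b 18"
  by (rule config_bound[where ds = "[4, 0]" and ps =
    "[(4, 14, 17), (6, 14, 11), (2, 4, 15), (5, 8, 16), (0, 11, 3), (1, 9, 10), (13, 16, 17),
      (2, 16, 14), (3, 5, 9), (0, 15, 1), (6, 7, 17), (1, 13, 11), (10, 15, 12)]"],
      simp only: check_rules, simp_all add: inside_def)

lemma b_19: "43 \<le> b 19"
  by (rule config_bound[where ds = "[7]" and ps =
    "[(1, 11, 17), (1, 15, 6), (13, 18, 16), (6, 18, 11), (0, 15, 11), (9, 17, 14), (8, 10, 15),
      (0, 3, 6), (0, 10, 14), (3, 16, 4), (2, 5, 18), (2, 4, 12), (5, 17, 16), (1, 8, 7)]"],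
      simp only: check_rules, simp_all add: inside_def)

lemma b_20: "45 \<le> b 20"
  by (rule config_bound[where ds = "[]" and ps =
    "[(11, 18, 19), (0, 13, 4), (8, 18, 9), (1, 6, 3), (5, 13, 18), (0, 9, 11), (2, 19, 13),
      (1, 7, 17), (4, 14, 15), (2, 6, 19), (3, 17, 11), (2, 4, 5), (7, 16, 15), (6, 10, 16),
      (1, 3, 14)]"],
      simp only: check_rules, simp_all add: inside_def)

lemma b_21: "47 \<le> b 21"
  by (rule config_bound[where ds = "[14, 17]" and ps =
    "[(2, 4, 13), (2, 13, 8), (1, 15, 2), (0, 19, 5), (11, 16, 20), (5, 17, 12), (3, 18, 6),
      (5, 6, 18), (0, 4, 8), (3, 20, 17), (10, 18, 16), (6, 15, 20), (0, 11, 19), (1, 7, 3),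
      (1, 19, 13)]"],
      simp only: check_rules, simp_all add: inside_def)

lemma b_22: "49 \<le> b 22"
  by (rule config_bound[where ds = "[4]" and ps =
    "[(1, 18, 13), (0, 16, 3), (7, 21, 11), (0, 7, 15), (8, 9, 21), (1, 3, 12), (1, 11, 9),
      (4, 9, 20), (16, 19, 18), (3, 10, 4), (6, 21, 15), (5, 19, 10), (0, 5, 2), (11, 20, 14),
      (2, 18, 20), (2, 10, 17)]"],
      simp only: check_rules, simp_all add: inside_def)

lemma b_23: "50 \<le> b 23"
  by (rule config_bound[where ds = "[22, 12]" and ps =
    "[(5, 22, 14), (7, 17, 9), (1, 18, 19), (2, 4, 18), (14, 15, 21), (2, 16, 21), (1, 7, 22),
      (5, 8, 15), (0, 4, 11), (9, 17, 21), (4, 20, 5), (3, 19, 18), (10, 19, 20), (0, 15, 12),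
      (10, 20, 16), (0, 13, 1)]"],
      simp only: check_rules, simp_all add: inside_def)

lemma b_24: "52 \<le> b 24"
  by (rule config_bound[where ds = "[21]" and ps =
    "[(1, 10, 5), (1, 15, 19), (3, 23, 6), (3, 4, 8), (8, 20, 12), (0, 14, 4), (10, 20, 19),
      (0, 2, 19), (1, 17, 2), (2, 17, 10), (6, 23, 16), (14, 22, 20), (5, 21, 22), (4, 13, 22),
      (15, 16, 23), (0, 13, 15), (9, 16, 21)]"],
      simp only: check_rules, simp_all add: inside_def)

lemma b_25: "53 \<le> b 25"
  by (rule config_bound[where ds = "[8, 13]" and ps =
    "[(1, 8, 17), (0, 2, 13), (2, 22, 11), (9, 13, 23), (1, 5, 22), (6, 23, 14), (4, 23, 21),
      (0, 14, 3), (4, 24, 6), (0, 12, 21), (11, 19, 20), (2, 7, 9), (3, 6, 7), (1, 19, 16),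
      (18, 20, 20), (4, 21, 22), (10, 19, 24)]"],
      simp only: check_rules, simp_all add: inside_def)

lemma b_27: "56 \<le> b 27"
  by (rule config_bound[where ds = "[16, 10]" and ps =
    "[(1, 25, 6), (11, 13, 26), (2, 23, 17), (2, 3, 26), (4, 20, 11), (0, 6, 7), (4, 18, 23),
      (5, 23, 12), (1, 14, 19), (10, 20, 22), (15, 21, 20), (9, 25, 17), (2, 4, 15), (8, 15, 26),
      (0, 3, 24), (8, 25, 24), (21, 24, 22), (0, 7, 11)]"],
      simp only: check_rules, simp_all add: inside_def)

lemma b_29: "59 \<le> b 29"
  by (rule config_bound[where ds = "[12, 4]" and ps =
    "[(2, 4, 7), (9, 20, 10), (18, 25, 27), (7, 25, 26), (2, 21, 22), (5, 11, 21), (9, 15, 28),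
      (21, 28, 23), (8, 27, 19), (0, 13, 7), (0, 6, 17), (11, 12, 26), (20, 24, 27), (1, 9, 18),
      (1, 17, 8), (15, 19, 19), (4, 26, 10), (1, 18, 14), (11, 20, 28)]"],
      simp only: check_rules, simp_all add: inside_def)

theorem mainTheorem5:
  shows "b 9 \<ge> 23 \<and> b 10 \<ge> 26 \<and> b 11 \<ge> 28 \<and> b 12 \<ge> 31 \<and> b 13 \<ge> 32 \<and> b 14 \<ge> 34 \<and> b 15 \<ge> 35 \<and>
         b 16 \<ge> 38 \<and> b 17 \<ge> 38 \<and> b 18 \<ge> 41 \<and> b 19 \<ge> 43 \<and> b 20 \<ge> 45 \<and> b 21 \<ge> 47 \<and> b 22 \<ge> 49 \<and>
         b 23 \<ge> 50 \<and> b 24 \<ge> 52 \<and> b 25 \<ge> 53 \<and> b 26 \<ge> 53 \<and> b 27 \<ge> 56 \<and> b 28 \<ge> 56 \<and> b 29 \<ge> 59"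
proof -
  \<comment> \<open>These three sizes inherit the configuration of the preceding one by
    monotonicity.\<close>
  have "38 \<le> b 17" "53 \<le> b 26" "56 \<le> b 28"
    using b_16 b_25 b_27 b_mono[of 16 17] b_mono[of 25 26] b_mono[of 27 28] by simp_all
  then show ?thesis
    using b_9 b_10 b_11 b_12 b_13 b_14 b_15 b_16 b_18 b_19 b_20 b_21 b_22 b_23 b_24 b_25 b_27 b_29
    by blast
qed

end
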